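(* Let $1\le m<n$, let $\lambda_1<\dots<\lambda_n$ be real numbers in an open interval $(a,b)$, and let $w_1,\dots,w_n\in\mathbb{C}\setminus\{0\}$. Let $s\in\mathbb{R}$ be distinct from $\lambda_1,\dots,\lambda_n$, and let $\theta_1<\dots<\theta_m$ in $(a,b)$, all distinct from $s$, and $c_1,\dots,c_m\in\mathbb{C}$ satisfy $$\sum_{j=1}^n |w_j|^2\, r(\lambda_j)=\sum_{j=1}^m |c_j|^2\, r(\theta_j)\qquad\text{for all } r(\lambda)=\frac{p(\lambda)}{(\lambda-s)^{2m-2}},\ p\in\Pi_{2m-2}.$$ With the step functions $\alpha_n,\alpha_m$ and the index $k_m$ defined in the context, set $\gamma=\alpha_n(s)-\alpha_m(s)$. Then $$\alpha_n(\theta_k)\le |c_1|^2+\dots+|c_k|^2+\gamma\le\alpha_n(\theta_{k+1}-),\qquad k=1,\dots,m-1,$$ and both inequalities are strict for $k\ne k_m$. Additionally, if $k_m\neq m$, then $$\alpha_n(\theta_m)\le |c_1|^2+\dots+|c_m|^2+\gamma\qquad\text{and}\qquad \gamma\le\alpha_n(\theta_1-).$$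
   Context: $\Pi_j$ denotes the complex polynomials of degree $\le j$. The step functions are $\alpha_n(\lambda)=\sum_{j:\ \lambda_j\le\lambda}|w_j|^2$ and $\alpha_m(\lambda)=\sum_{j:\ \theta_j\le\lambda}|c_j|^2$ for $\lambda\in\mathbb{R}$, and $\alpha_n(\theta-)=\lim_{\varepsilon\to0+}\alpha_n(\theta-\varepsilon)=\sum_{j:\ \lambda_j<\theta}|w_j|^2$. The index $k_m$: if $s\in(\theta_1,\theta_m)$, then $k_m$ is defined by $\theta_{k_m}<s<\theta_{k_m+1}$; if $s<\theta_1$ or $s>\theta_m$, then $k_m=m$. *)

theory Defs
  imports
    Complex_Main
    "HOL-Library.Extended_Real"
    "HOL-Computational_Algebra.Polynomial"
begin

definition step_fun :: "nat \<Rightarrow> (nat \<Rightarrow> real) \<Rightarrow> (nat \<Rightarrow> complex) \<Rightarrow> real \<Rightarrow> real" where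
  "step_fun N x u t = (\<Sum>j | j \<in> {1..N} \<and> x j \<le> t. (cmod (u j))\<^sup>2)"

definition left_lim :: "(real \<Rightarrow> real) \<Rightarrow> real \<Rightarrow> real" where
  "left_lim f t = Lim (at_left t) f"

lemma left_lim_step_fun:
  "left_lim (step_fun N x u) t = (\<Sum>j | j \<in> {1..N} \<and> x j < t. (cmod (u j))\<^sup>2)"
proof -
  have "\<forall>\<^sub>F y in at_left t. x j \<le> y \<longleftrightarrow> x j < t" for j
  proof (cases "x j < t")
    case True
    then show ?thesis
      by (auto simp: eventually_at_left_field intro!: exI[of _ "x j"])
  next
    case False
    then show ?thesis
      by (auto simp: eventually_at_left_field intro!: exI[of _ "t - 1"])
  qed
  then have "\<forall>\<^sub>F y in at_left t. \<forall>j\<in>{1..N}. x j \<le> y \<longleftrightarrow> x j < t"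
    by (intro eventually_ball_finite) auto
  then have "\<forall>\<^sub>F y in at_left t.
      step_fun N x u y = (\<Sum>j | j \<in> {1..N} \<and> x j < t. (cmod (u j))\<^sup>2)"
    by eventually_elim (auto simp: step_fun_def intro!: sum.cong)
  then show ?thesis
    unfolding left_lim_def by (intro tendsto_Lim tendsto_eventually) auto
qed

text \<open>
  The index \<open>k_m\<close> of the increasing nodes \<open>\<theta> 1 < \<dots> < \<theta> m\<close> relative to \<open>s\<close>, where
  \<open>s\<close> is assumed not to be a node; the \<open>else\<close> branch is then the case \<open>s < \<theta> 1\<close> or \<open>s > \<theta> m\<close>.
\<close>
definition gap_index :: "nat \<Rightarrow> (nat \<Rightarrow> real) \<Rightarrow> real \<Rightarrow> nat" where
  "gap_index m \<theta> s =
    (if \<theta> 1 < s \<and> s < \<theta> m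
     then THE k. k \<in> {1..<m} \<and> \<theta> k < s \<and> s < \<theta> (k + 1)
     else m)"

end

theory Submission
  imports Defs
begin

text \<open>
  Under \<open>x = 1/(t - s)\<close> the rational functions with denominator \<open>(t - s)\<^sup>2\<^sup>m\<^sup>-\<^sup>2\<close> become the
  polynomials of degree at most \<open>2m - 2\<close> in \<open>x\<close>, so the hypothesis says that an \<open>m\<close>-point
  quadrature rule is exact up to degree \<open>2m - 2\<close>. As in the Chebyshev--Markov--Stieltjes
  inequalities, a polynomial of that degree majorizes the indicator of a half-line ending
  at a node, agrees with it at all nodes, and exceeds it elsewhere unless all nodes lie in the
  half-line. Half-lines in \<open>x\<close>
  correspond to intervals between \<open>s\<close> and a node \<open>\<theta> k\<close>, and the inequalities between the masses of
  these intervals are the claimed ones. Strictness holds because \<open>m < n\<close> leaves some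
  \<open>lam i\<close> outside the nodes.
\<close>

section \<open>Degrees of products of linear factors and splitting of finite sums\<close>

lemma degree_prod_list_le:
  fixes p :: "'a \<Rightarrow> 'b::comm_semiring_1 poly"
  assumes "\<And>a. degree (p a) \<le> 1"
  shows "degree (\<Prod>a\<leftarrow>as. p a) \<le> length as"
proof (induction as)
  case (Cons a as)
  have "degree (p a * (\<Prod>a\<leftarrow>as. p a)) \<le> degree (p a) + degree (\<Prod>a\<leftarrow>as. p a)"
    by (rule degree_mult_le)
  with Cons assms[of a] show ?case by simp
qed simp

lemma sum_Collect_split:
  fixes f :: "'a \<Rightarrow> 'b::comm_monoid_add"
  assumes "finite I" "\<And>i. i \<in> I \<Longrightarrow> P i \<longleftrightarrow> Q i \<or> R i" "\<And>i. i \<in> I \<Longrightarrow> \<not> (Q i \<and> R i)"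
  shows "(\<Sum>i | i \<in> I \<and> P i. f i) = (\<Sum>i | i \<in> I \<and> Q i. f i) + (\<Sum>i | i \<in> I \<and> R i. f i)"
proof -
  have "{i. i \<in> I \<and> P i} = {i. i \<in> I \<and> Q i} \<union> {i. i \<in> I \<and> R i}"
    using assms(2) by auto
  then show ?thesis
    using assms by (simp only:) (intro sum.union_disjoint, auto)
qed

lemma sum_split_at:
  fixes f :: "'a \<Rightarrow> 'b::comm_monoid_add" and y :: "'a \<Rightarrow> 'c::linorder"
  assumes "finite I"
  shows "sum f I = (\<Sum>i | i \<in> I \<and> y i < r. f i) + (\<Sum>i | i \<in> I \<and> r \<le> y i. f i)"
proof -
  have "(\<Sum>i | i \<in> I \<and> True. f i) = (\<Sum>i | i \<in> I \<and> y i < r. f i) + (\<Sum>i | i \<in> I \<and> r \<le> y i. f i)"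
    by (rule sum_Collect_split) (use assms in auto)
  then show ?thesis by simp
qed

section \<open>Positive Bezout cofactors and the majorant of a half-line\<close>

text \<open>
  Expand \<open>1\<close> along a lattice walk: when the first unused elements of the two lists are
  \<open>a\<close> and \<open>y\<close>, use \<open>1 = (a - x)/(a - y) + (x - y)/(a - y)\<close> and discard \<open>a\<close> in the first
  summand and \<open>y\<close> in the second. The walks that use up \<open>as\<close> first contribute to \<open>g\<close>, those
  that use up \<open>ys\<close> first contribute to \<open>h\<close>.
\<close>
lemma positive_bezout:
  fixes as ys :: "real list"
  assumes "\<And>a y. a \<in> set as \<Longrightarrow> y \<in> set ys \<Longrightarrow> y < a" and "as \<noteq> [] \<or> ys \<noteq> []"
  shows "\<exists>g h. (\<Prod>a\<leftarrow>as. [:a, -1:]) * g + (\<Prod>y\<leftarrow>ys. [:-y, 1:]) * h = 1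
    \<and> degree g \<le> length ys - 1 \<and> degree h \<le> length as - 1
    \<and> (if ys = [] then g = 0 else \<forall>x. (\<forall>y\<in>set ys. y \<le> x) \<longrightarrow> 0 < poly g x)
    \<and> (if as = [] then h = 0 else \<forall>x. (\<forall>a\<in>set as. x \<le> a) \<longrightarrow> 0 < poly h x)"
  using assms
proof (induction "length as + length ys" arbitrary: as ys rule: less_induct)
  case less
  show ?case
  proof (cases "as = [] \<or> ys = []")
    case True
    then show ?thesis
    proof
      assume "as = []"
      with less.prems show ?thesis by (intro exI[of _ 1] exI[of _ 0]) auto
    next
      assume "ys = []"
      with less.prems show ?thesis by (intro exI[of _ 0] exI[of _ 1]) auto
    qed
  next
    case False
    then obtain a as' y ys' where eq: "as = a # as'" "ys = y # ys'"
      by (metis neq_Nil_conv)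
    define A where "A = (\<Prod>a\<leftarrow>as'. [:a, -1:])"
    define Y where "Y = (\<Prod>y\<leftarrow>ys'. [:-y, 1:])"
    have "y < a" using less.prems(1) eq by auto
    obtain g1 h1 where 1: "A * g1 + [:-y, 1:] * Y * h1 = 1"
      "degree g1 \<le> length ys'" "degree h1 \<le> length as' - 1"
      "\<And>x. (\<forall>y\<in>set ys. y \<le> x) \<Longrightarrow> 0 < poly g1 x"
      "if as' = [] then h1 = 0 else \<forall>x. (\<forall>a\<in>set as'. x \<le> a) \<longrightarrow> 0 < poly h1 x"
      using less.hyps[of as' ys] less.prems unfolding eq A_def Y_def by auto
    obtain g2 h2 where 2: "[:a, -1:] * A * g2 + Y * h2 = 1"
      "degree g2 \<le> length ys' - 1" "degree h2 \<le> length as'"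
      "if ys' = [] then g2 = 0 else \<forall>x. (\<forall>y\<in>set ys'. y \<le> x) \<longrightarrow> 0 < poly g2 x"
      "\<And>x. (\<forall>a\<in>set as. x \<le> a) \<Longrightarrow> 0 < poly h2 x"
      using less.hyps[of as ys'] less.prems unfolding eq A_def Y_def by auto
    define g where "g = smult (1 / (a - y)) (g1 + [:-y, 1:] * g2)"
    define h where "h = smult (1 / (a - y)) ([:a, -1:] * h1 + h2)"
    have scale: "smult (a - y) (P * smult (1 / (a - y)) G + Q * smult (1 / (a - y)) H) = P * G + Q * H"
      for P Q G H :: "real poly"
      using \<open>y < a\<close> by (simp add: smult_add_right)
    have "smult (a - y) ([:a, -1:] * A * g + [:-y, 1:] * Y * h)
        = [:a, -1:] * A * (g1 + [:-y, 1:] * g2) + [:-y, 1:] * Y * ([:a, -1:] * h1 + h2)"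
      unfolding g_def h_def by (rule scale)
    \<comment> \<open>Regrouping isolates the two smaller identities, with the factors
      \<open>a - x\<close> and \<open>x - y\<close>, whose sum is the constant
      \<open>a - y\<close>.\<close>
    also have "\<dots> = [:a, -1:] * (A * g1 + [:-y, 1:] * Y * h1)
        + [:-y, 1:] * ([:a, -1:] * A * g2 + Y * h2)"
      by (simp add: algebra_simps del: mult_pCons_left mult_pCons_right)
    also have "\<dots> = smult (a - y) 1"
      unfolding 1 2 by simp
    finally have "[:a, -1:] * A * g + [:-y, 1:] * Y * h = 1"
      using \<open>y < a\<close> by (metis diff_gt_0_iff_gt less_irrefl smult_cancel)
    moreover have "degree g \<le> length ys'"
    proof -
      \<comment> \<open>The linear factor costs one degree. For \<open>ys' = []\<close> the
        truncated bound on \<open>degree g2\<close> leaves no room for it, but then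
        \<open>g2 = 0\<close>. The term with \<open>h1\<close> below is treated in the same
        way.\<close>
      have "degree ([:-y, 1:] * g2) \<le> length ys'"
        using 2(2,4) degree_mult_le[of "[:-y, 1:]" g2] by (cases ys') auto
      with 1(2) show ?thesis
        unfolding g_def by (intro order.trans[OF degree_smult_le] degree_add_le)
    qed
    moreover have "degree h \<le> length as'"
    proof -
      have "degree ([:a, -1:] * h1) \<le> length as'"
        using 1(3,5) degree_mult_le[of "[:a, -1:]" h1] by (cases as') auto
      with 2(3) show ?thesis
        unfolding h_def by (intro order.trans[OF degree_smult_le] degree_add_le)
    qed
    moreover have "0 < poly g x" if "\<forall>y\<in>set ys. y \<le> x" for x
    proof -
      have "0 \<le> poly g2 x"
        using 2(4) that eq by (cases "ys' = []") (auto intro: less_imp_le)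
      then have "0 \<le> (x - y) * poly g2 x"
        using that eq by auto
      with 1(4)[OF that] \<open>y < a\<close> show ?thesis
        by (auto simp: g_def field_simps intro!: mult_pos_pos)
    qed
    moreover have "0 < poly h x" if "\<forall>a\<in>set as. x \<le> a" for x
    proof -
      have "0 \<le> poly h1 x"
        using 1(5) that eq by (cases "as' = []") (auto intro: less_imp_le)
      then have "0 \<le> (a - x) * poly h1 x"
        using that eq by auto
      with 2(5)[OF that] \<open>y < a\<close> show ?thesis
        by (auto simp: h_def field_simps intro!: mult_pos_pos)
    qed
    ultimately show ?thesis
      unfolding eq A_def Y_def by (intro exI[of _ g] exI[of _ h]) auto
  qed
qed

text \<open>The Bezout identity writes \<open>q\<close> in two ways: as \<open>A\<^sup>2 g\<close>,
  where \<open>A\<close> vanishes at the nodes right of \<open>\<xi>\<close>, and as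
  \<open>1 + (\<xi> - x) B\<^sup>2 h\<close>, where \<open>B\<close> vanishes at the nodes left of
  \<open>\<xi>\<close>. The first form controls \<open>q\<close> right of \<open>\<xi>\<close>, the
  second controls it up to \<open>\<xi>\<close>.\<close>

lemma poly_majorant_of_halfline:
  fixes X :: "real set"
  assumes "finite X" "\<xi> \<in> X"
  obtains q :: "real poly" where
    "degree q \<le> 2 * card X - 2"
    "\<And>x. x \<in> X \<Longrightarrow> poly q x = of_bool (x \<le> \<xi>)"
    "\<And>x. of_bool (x \<le> \<xi>) \<le> poly q x"
    "\<And>x \<eta>. \<eta> \<in> X \<Longrightarrow> \<xi> < \<eta> \<Longrightarrow> x \<notin> X \<Longrightarrow> of_bool (x \<le> \<xi>) < poly q x"
proof -
  define L where "L = sorted_list_of_set {x \<in> X. x < \<xi>}"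
  define R where "R = sorted_list_of_set {x \<in> X. \<xi> < x}"
  have sets: "set L = {x \<in> X. x < \<xi>}" "set R = {x \<in> X. \<xi> < x}"
    using assms by (auto simp: L_def R_def)
  have len: "length L = card {x \<in> X. x < \<xi>}" "length R = card {x \<in> X. \<xi> < x}"
    by (auto simp: L_def R_def)
  have "X = insert \<xi> ({x \<in> X. x < \<xi>} \<union> {x \<in> X. \<xi> < x})"
    using assms by auto
  then have "card X = card (insert \<xi> ({x \<in> X. x < \<xi>} \<union> {x \<in> X. \<xi> < x}))"
    by (rule arg_cong)
  also have "\<dots> = Suc (card ({x \<in> X. x < \<xi>} \<union> {x \<in> X. \<xi> < x}))"
    using assms by (intro card_insert_disjoint) auto
  also have "card ({x \<in> X. x < \<xi>} \<union> {x \<in> X. \<xi> < x}) = length L + length R"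
    unfolding len using assms by (intro card_Un_disjoint) auto
  finally have card: "card X = Suc (length L + length R)" .
  \<comment> \<open>Every node except \<open>\<xi>\<close> is doubled, so that only the factor
    \<open>x - \<xi>\<close> changes sign. The degree of \<open>q\<close> is then at most
    \<open>2 * length R + 2 * length L\<close>, which is \<open>2 * card X - 2\<close>.\<close>
  define as where "as = R @ R"
  define ys where "ys = \<xi> # L @ L"
  \<comment> \<open>If no node lies right of \<open>\<xi>\<close>, then \<open>h = 0\<close> and
    \<open>q\<close> is the constant 1; hence the node \<open>\<eta>\<close> in the strict
    claim.\<close>
  obtain g h where
    bezout: "(\<Prod>a\<leftarrow>as. [:a, -1:]) * g + (\<Prod>y\<leftarrow>ys. [:-y, 1:]) * h = 1"
    and deg: "degree g \<le> length ys - 1"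
    and g_pos: "\<And>x. \<xi> \<le> x \<Longrightarrow> 0 < poly g x"
    and h_pos: "\<And>x. x \<le> \<xi> \<Longrightarrow> if R = [] then h = 0 else 0 < poly h x"
    using positive_bezout[of as ys] sets unfolding as_def ys_def
    by (fastforce split: if_splits)
  define A where "A x = (\<Prod>a\<leftarrow>R. a - x)" for x
  define B where "B x = (\<Prod>y\<leftarrow>L. x - y)" for x
  have poly_R: "poly (\<Prod>a\<leftarrow>l. [:a, -1:]) x = (\<Prod>a\<leftarrow>l. a - x)" for l :: "real list" and x
    by (induction l) (auto simp: algebra_simps)
  have poly_L: "poly (\<Prod>y\<leftarrow>l. [:-y, 1:]) x = (\<Prod>y\<leftarrow>l. x - y)" for l :: "real list" and x
    by (induction l) (auto simp: algebra_simps)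
  have A_eq: "poly (\<Prod>a\<leftarrow>as. [:a, -1:]) x = (A x)\<^sup>2" for x
    by (simp add: poly_R as_def A_def power2_eq_square)
  have Y_eq: "poly (\<Prod>y\<leftarrow>ys. [:-y, 1:]) x = (x - \<xi>) * (B x)\<^sup>2" for x
    unfolding poly_L by (simp add: ys_def B_def power2_eq_square)
  define q where "q = (\<Prod>a\<leftarrow>as. [:a, -1:]) * g"
  have q_right: "poly q x = (A x)\<^sup>2 * poly g x" for x
    by (simp add: q_def A_eq)
  have q_left: "poly q x = 1 + (\<xi> - x) * (B x)\<^sup>2 * poly h x" for x
    using arg_cong[OF bezout, of "\<lambda>p. poly p x"]
    by (simp add: q_right A_eq Y_eq algebra_simps)
  have A_zero: "A x = 0 \<longleftrightarrow> x \<in> X \<and> \<xi> < x" for x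
    unfolding A_def prod_list_zero_iff set_map sets image_iff by auto
  have B_zero: "B x = 0 \<longleftrightarrow> x \<in> X \<and> x < \<xi>" for x
    unfolding B_def prod_list_zero_iff set_map sets image_iff by auto
  show thesis
  proof
    have "degree q \<le> length as + (length ys - 1)"
      unfolding q_def
      by (intro order.trans[OF degree_mult_le] add_mono deg degree_prod_list_le) simp
    then show "degree q \<le> 2 * card X - 2"
      by (simp add: as_def ys_def card)
    show "poly q x = of_bool (x \<le> \<xi>)" if "x \<in> X" for x
    proof (cases "x \<le> \<xi>")
      case True
      then have "x = \<xi> \<or> B x = 0" using that B_zero by force
      with True show ?thesis by (auto simp: q_left)
    next
      case False
      with that A_zero show ?thesis by (auto simp: q_right)
    qed
    show "of_bool (x \<le> \<xi>) \<le> poly q x" for x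
    proof (cases "x \<le> \<xi>")
      case True
      then have "0 \<le> poly h x" using h_pos[of x] by (auto split: if_splits)
      with True show ?thesis by (simp add: q_left)
    next
      case False
      then show ?thesis using g_pos[of x] by (simp add: q_right)
    qed
    show "of_bool (x \<le> \<xi>) < poly q x" if "\<eta> \<in> X" "\<xi> < \<eta>" "x \<notin> X" for x \<eta>
    proof (cases "x \<le> \<xi>")
      case True
      have "\<eta> \<in> set R" using that sets by simp
      then have "0 < poly h x" using h_pos[OF True] by (auto split: if_splits)
      moreover have "x < \<xi>" using True that assms by (cases "x = \<xi>") auto
      ultimately show ?thesis using that B_zero by (simp add: q_left)
    next
      case False
      then show ?thesis using g_pos[of x] that A_zero by (simp add: q_right)
    qed
  qed
qed

section \<open>Chebyshev--Markov--Stieltjes inequalities for a quadrature rule\<close>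

text \<open>The nodes form an indexed family without an order, since the substitution applied later
  does not preserve their order. The degree of exactness is that of the majorants, one less than for
  Gauss quadrature.\<close>

locale quadrature =
  fixes I :: "'i set" and J :: "'j set" and y :: "'i \<Rightarrow> real" and x :: "'j \<Rightarrow> real"
    and u :: "'i \<Rightarrow> real" and v :: "'j \<Rightarrow> real"
  assumes finite: "finite I" "finite J"
    and inj: "inj_on x J"
    and nonneg: "\<And>i. i \<in> I \<Longrightarrow> 0 \<le> u i"
    and exact: "\<And>q. degree q \<le> 2 * card J - 2 \<Longrightarrow>
      (\<Sum>i\<in>I. u i * poly q (y i)) = (\<Sum>j\<in>J. v j * poly q (x j))"
begin

text \<open>Composition with \<open>- x\<close> keeps the degree. Reflection exchanges left and
  right half-lines, so that each bound yields a companion.\<close>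

lemma quadrature_uminus: "quadrature I J (\<lambda>i. - y i) (\<lambda>j. - x j) u v"
proof
  fix q :: "real poly" assume "degree q \<le> 2 * card J - 2"
  then show "(\<Sum>i\<in>I. u i * poly q (- y i)) = (\<Sum>j\<in>J. v j * poly q (- x j))"
    using exact[of "pcompose q [:0, -1:]"] by (simp add: degree_pcompose poly_pcompose)
qed (use finite inj nonneg in \<open>auto simp: inj_on_def\<close>)

lemma total_eq: "sum u I = sum v J"
  using exact[of 1] by simp

text \<open>Apply the rule to the majorant \<open>q\<close> of the half-line ending at
  \<open>x k\<close>. On the side of \<open>J\<close> it returns exactly the mass of the half-line,
  on the side of \<open>I\<close> at least the mass there. A point of positive weight off the nodes
  makes the latter strict once some node lies right of \<open>x k\<close>.\<close>

lemma sum_le_node: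
  assumes "k \<in> J"
  shows "(\<Sum>i | i \<in> I \<and> y i \<le> x k. u i) \<le> (\<Sum>j | j \<in> J \<and> x j \<le> x k. v j)"
    and "\<lbrakk>l \<in> J; x k < x l; i \<in> I; 0 < u i; y i \<notin> x ` J\<rbrakk> \<Longrightarrow>
      (\<Sum>i | i \<in> I \<and> y i \<le> x k. u i) < (\<Sum>j | j \<in> J \<and> x j \<le> x k. v j)"
proof -
  obtain q :: "real poly" where deg: "degree q \<le> 2 * card (x ` J) - 2"
    and nodes: "\<And>t. t \<in> x ` J \<Longrightarrow> poly q t = of_bool (t \<le> x k)"
    and le: "\<And>t. of_bool (t \<le> x k) \<le> poly q t"
    and less: "\<And>t \<eta>. \<eta> \<in> x ` J \<Longrightarrow> x k < \<eta> \<Longrightarrow> t \<notin> x ` J \<Longrightarrow> of_bool (t \<le> x k) < poly q t"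
    using poly_majorant_of_halfline[of "x ` J" "x k"] assms finite by auto
  have "(\<Sum>i\<in>I. u i * poly q (y i)) = (\<Sum>j\<in>J. v j * poly q (x j))"
    using deg by (intro exact) (simp add: card_image inj)
  also have "\<dots> = (\<Sum>j\<in>J. if x j \<le> x k then v j else 0)"
    by (intro sum.cong) (auto simp: nodes)
  also have "\<dots> = (\<Sum>j | j \<in> J \<and> x j \<le> x k. v j)"
    using finite by (simp add: sum.inter_filter[symmetric])
  finally have R: "(\<Sum>i\<in>I. u i * poly q (y i)) = (\<Sum>j | j \<in> J \<and> x j \<le> x k. v j)" .
  have L: "(\<Sum>i | i \<in> I \<and> y i \<le> x k. u i) = (\<Sum>i\<in>I. u i * of_bool (y i \<le> x k))"
    using finite by (auto simp: sum.inter_filter[symmetric] intro!: sum.cong)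
  show "(\<Sum>i | i \<in> I \<and> y i \<le> x k. u i) \<le> (\<Sum>j | j \<in> J \<and> x j \<le> x k. v j)"
    unfolding L R[symmetric] by (intro sum_mono mult_left_mono le nonneg)
  show "(\<Sum>i | i \<in> I \<and> y i \<le> x k. u i) < (\<Sum>j | j \<in> J \<and> x j \<le> x k. v j)"
    if "l \<in> J" "x k < x l" "i \<in> I" "0 < u i" "y i \<notin> x ` J"
    unfolding L R[symmetric]
  proof (rule sum_strict_mono_ex1)
    show "\<forall>i\<in>I. u i * of_bool (y i \<le> x k) \<le> u i * poly q (y i)"
      by (intro ballI mult_left_mono le nonneg)
    show "\<exists>i\<in>I. u i * of_bool (y i \<le> x k) < u i * poly q (y i)"
      by (intro bexI[of _ i] mult_strict_left_mono less[of "x l"] imageI that)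
  qed (rule finite)
qed

text \<open>The reflected \<open>sum_le_node\<close> bounds the mass at or right of
  \<open>x k\<close>; subtraction from the equal totals reverses the inequality.\<close>

lemma sum_less_node:
  assumes "k \<in> J"
  shows "(\<Sum>j | j \<in> J \<and> x j < x k. v j) \<le> (\<Sum>i | i \<in> I \<and> y i < x k. u i)"
    and "\<lbrakk>l \<in> J; x l < x k; i \<in> I; 0 < u i; y i \<notin> x ` J\<rbrakk> \<Longrightarrow>
      (\<Sum>j | j \<in> J \<and> x j < x k. v j) < (\<Sum>i | i \<in> I \<and> y i < x k. u i)"
proof -
  interpret neg: quadrature I J "\<lambda>i. - y i" "\<lambda>j. - x j" u v
    by (rule quadrature_uminus)
  have I: "sum u I = (\<Sum>i | i \<in> I \<and> y i < x k. u i) + (\<Sum>i | i \<in> I \<and> x k \<le> y i. u i)"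
    by (rule sum_split_at) (rule finite)
  have J: "sum v J = (\<Sum>j | j \<in> J \<and> x j < x k. v j) + (\<Sum>j | j \<in> J \<and> x k \<le> x j. v j)"
    by (rule sum_split_at) (rule finite)
  show "(\<Sum>j | j \<in> J \<and> x j < x k. v j) \<le> (\<Sum>i | i \<in> I \<and> y i < x k. u i)"
    using neg.sum_le_node(1)[OF assms] I J total_eq by simp
  show "(\<Sum>j | j \<in> J \<and> x j < x k. v j) < (\<Sum>i | i \<in> I \<and> y i < x k. u i)"
    if "l \<in> J" "x l < x k" "i \<in> I" "0 < u i" "y i \<notin> x ` J"
    using neg.sum_le_node(2)[OF assms, of l i] that I J total_eq by (auto simp: image_iff)
qed

end

section \<open>The substitution sending the pole to infinity\<close>

text \<open>Multiplying \<open>poly q (\<kappa> / (t - s))\<close> by \<open>(t - s) ^ N\<close>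
  clears the denominators and leaves a polynomial in \<open>t - s\<close>. It is taken complex to
  match the test functions of the theorem.\<close>

lemma poly_inverse_shift:
  fixes q :: "real poly" and \<kappa> s :: real
  assumes "degree q \<le> N"
  obtains p :: "complex poly" where "degree p \<le> N"
    "\<And>t. t \<noteq> s \<Longrightarrow>
      poly p (of_real t) / (of_real t - of_real s) ^ N = of_real (poly q (\<kappa> / (t - s)))"
proof
  let ?p = "\<Sum>i\<le>N. smult (of_real (coeff q i * \<kappa> ^ i)) ([:- of_real s, 1:] ^ (N - i)) :: complex poly"
  show "degree ?p \<le> N"
    by (intro degree_sum_le order.trans[OF degree_smult_le]
        order.trans[OF degree_power_le]) auto
  fix t :: real assume "t \<noteq> s"
  then have nz: "complex_of_real t - of_real s \<noteq> 0" by simp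
  have "poly ?p (of_real t) / (of_real t - of_real s) ^ N
      = (\<Sum>i\<le>N. of_real (coeff q i * \<kappa> ^ i) * (of_real t - of_real s) ^ (N - i)
          / (of_real t - of_real s) ^ N)"
    by (simp add: poly_sum sum_divide_distrib)
  also have "\<dots> = (\<Sum>i\<le>N. of_real (coeff q i * (\<kappa> / (t - s)) ^ i))"
    using nz by (intro sum.cong) (auto simp: power_diff power_divide field_simps)
  also have "\<dots> = of_real (\<Sum>i\<le>N. coeff q i * (\<kappa> / (t - s)) ^ i)"
    by simp
  also have "(\<Sum>i\<le>N. coeff q i * (\<kappa> / (t - s)) ^ i) = poly q (\<kappa> / (t - s))"
    unfolding poly_altdef using assms
    by (intro sum.mono_neutral_right) (auto simp: coeff_eq_0)
  finally show "poly ?p (of_real t) / (of_real t - of_real s) ^ N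
    = of_real (poly q (\<kappa> / (t - s)))" .
qed

text \<open>The sign is chosen so that the side of \<open>s\<close> containing \<open>a\<close> is
  mapped to negative numbers and the other side to positive ones. A left half-line ending at the
  image of \<open>a\<close> thus picks out only points between \<open>a\<close> and
  \<open>s\<close>.\<close>

lemma inverse_shift_order:
  fixes a b s :: real
  assumes "b \<noteq> s"
  shows "a < s \<Longrightarrow> 1 / (b - s) < 1 / (a - s) \<longleftrightarrow> a < b \<and> b < s"
    and "a < s \<Longrightarrow> 1 / (b - s) \<le> 1 / (a - s) \<longleftrightarrow> a \<le> b \<and> b < s"
    and "s < a \<Longrightarrow> - 1 / (b - s) < - 1 / (a - s) \<longleftrightarrow> s < b \<and> b < a"
    and "s < a \<Longrightarrow> - 1 / (b - s) \<le> - 1 / (a - s) \<longleftrightarrow> s < b \<and> b \<le> a"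
  using assms by (cases "b < s"; simp add: divide_simps; linarith)+

text \<open>
  The substitution \<open>x = \<kappa>/(t - s)\<close> moves \<open>s\<close> to infinity, so half-lines in \<open>x\<close> become the
  intervals between \<open>s\<close> and a node; \<open>\<kappa> = 1\<close> serves nodes left of \<open>s\<close>, \<open>\<kappa> = -1\<close> nodes
  right of \<open>s\<close>.
\<close>
locale pole_quadrature =
  fixes I :: "'i set" and J :: "'j set" and t :: "'i \<Rightarrow> real" and \<theta> :: "'j \<Rightarrow> real"
    and u :: "'i \<Rightarrow> real" and v :: "'j \<Rightarrow> real" and s :: real
  assumes quadrature: "\<And>\<kappa>. \<kappa> \<noteq> 0 \<Longrightarrow>
      quadrature I J (\<lambda>i. \<kappa> / (t i - s)) (\<lambda>j. \<kappa> / (\<theta> j - s)) u v"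
    and pole: "\<And>i. i \<in> I \<Longrightarrow> t i \<noteq> s" "\<And>j. j \<in> J \<Longrightarrow> \<theta> j \<noteq> s"
    and off_nodes: "\<exists>i\<in>I. 0 < u i \<and> t i \<notin> \<theta> ` J"
begin

lemma finite: "finite I" "finite J"
  using quadrature.finite[OF quadrature[of 1]] by auto

lemma off_nodes_shifted:
  assumes "\<kappa> \<noteq> 0"
  obtains i where "i \<in> I" "0 < u i" "\<kappa> / (t i - s) \<notin> (\<lambda>j. \<kappa> / (\<theta> j - s)) ` J"
proof -
  obtain i where i: "i \<in> I" "0 < u i" "t i \<notin> \<theta> ` J"
    using off_nodes by blast
  have "\<kappa> / (t i - s) \<noteq> \<kappa> / (\<theta> j - s)" if "j \<in> J" for j
    using pole i that assms by (auto simp: field_simps)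
  with i that show thesis by blast
qed

text \<open>The values of \<open>T - \<Theta>\<close> at \<open>\<theta> k\<close> and at
  \<open>s\<close> differ by the masses of the interval between them. If
  \<open>\<theta> k < s\<close>, the open interval has at least as much \<open>u\<close>-mass as
  \<open>v\<close>-mass; if \<open>s < \<theta> k\<close>, the interval including
  \<open>\<theta> k\<close> has at most as much. For strictness, the image of
  \<open>\<theta> l\<close> lies inside the half-line in the first case and outside it in the
  second.\<close>

lemma node_le:
  assumes k: "k \<in> J"
  defines "T \<equiv> \<lambda>P. \<Sum>i | i \<in> I \<and> P (t i). u i" and "\<Theta> \<equiv> \<lambda>P. \<Sum>j | j \<in> J \<and> P (\<theta> j). v j"
  shows "T (\<lambda>r. r \<le> \<theta> k) - \<Theta> (\<lambda>r. r \<le> \<theta> k) \<le> T (\<lambda>r. r \<le> s) - \<Theta> (\<lambda>r. r \<le> s)"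
    and "\<lbrakk>l \<in> J; \<theta> k < \<theta> l \<and> \<theta> l < s \<or> s < \<theta> k \<and> (\<theta> k < \<theta> l \<or> \<theta> l < s)\<rbrakk> \<Longrightarrow>
      T (\<lambda>r. r \<le> \<theta> k) - \<Theta> (\<lambda>r. r \<le> \<theta> k) < T (\<lambda>r. r \<le> s) - \<Theta> (\<lambda>r. r \<le> s)"
proof -
  have both: "T (\<lambda>r. r \<le> \<theta> k) - \<Theta> (\<lambda>r. r \<le> \<theta> k) \<le> T (\<lambda>r. r \<le> s) - \<Theta> (\<lambda>r. r \<le> s) \<and>
      (l \<in> J \<longrightarrow> \<theta> k < \<theta> l \<and> \<theta> l < s \<or> s < \<theta> k \<and> (\<theta> k < \<theta> l \<or> \<theta> l < s) \<longrightarrow>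
      T (\<lambda>r. r \<le> \<theta> k) - \<Theta> (\<lambda>r. r \<le> \<theta> k) < T (\<lambda>r. r \<le> s) - \<Theta> (\<lambda>r. r \<le> s))" for l
  proof (cases "\<theta> k < s")
    case True
    interpret Q: quadrature I J "\<lambda>i. 1 / (t i - s)" "\<lambda>j. 1 / (\<theta> j - s)" u v
      by (rule quadrature) simp
    obtain i where i: "i \<in> I" "0 < u i" "1 / (t i - s) \<notin> (\<lambda>j. 1 / (\<theta> j - s)) ` J"
      using off_nodes_shifted[of 1] by auto
    have I: "T (\<lambda>r. r \<le> s) = T (\<lambda>r. r \<le> \<theta> k) + (\<Sum>i | i \<in> I \<and> 1 / (t i - s) < 1 / (\<theta> k - s). u i)"
      unfolding T_def
    proof (rule sum_Collect_split)
      show "t i \<le> s \<longleftrightarrow> t i \<le> \<theta> k \<or> 1 / (t i - s) < 1 / (\<theta> k - s)"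
        "\<not> (t i \<le> \<theta> k \<and> 1 / (t i - s) < 1 / (\<theta> k - s))" if "i \<in> I" for i
        using inverse_shift_order(1)[OF pole(1)[OF that] True] pole(1)[OF that] True by auto
    qed (rule finite)
    have J: "\<Theta> (\<lambda>r. r \<le> s) = \<Theta> (\<lambda>r. r \<le> \<theta> k) + (\<Sum>j | j \<in> J \<and> 1 / (\<theta> j - s) < 1 / (\<theta> k - s). v j)"
      unfolding \<Theta>_def
    proof (rule sum_Collect_split)
      show "\<theta> j \<le> s \<longleftrightarrow> \<theta> j \<le> \<theta> k \<or> 1 / (\<theta> j - s) < 1 / (\<theta> k - s)"
        "\<not> (\<theta> j \<le> \<theta> k \<and> 1 / (\<theta> j - s) < 1 / (\<theta> k - s))" if "j \<in> J" for j
        using inverse_shift_order(1)[OF pole(2)[OF that] True] pole(2)[OF that] True by auto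
    qed (rule finite)
    have "1 / (\<theta> l - s) < 1 / (\<theta> k - s)" if "\<theta> k < \<theta> l" "\<theta> l < s"
      using inverse_shift_order(1)[of "\<theta> l" s "\<theta> k"] that True by auto
    then show ?thesis
      using Q.sum_less_node(1)[OF k] Q.sum_less_node(2)[OF k, of l i] i I J True by auto
  next
    case False
    with pole k have right: "s < \<theta> k" by force
    interpret Q: quadrature I J "\<lambda>i. - 1 / (t i - s)" "\<lambda>j. - 1 / (\<theta> j - s)" u v
      by (rule quadrature) simp
    obtain i where i: "i \<in> I" "0 < u i" "- 1 / (t i - s) \<notin> (\<lambda>j. - 1 / (\<theta> j - s)) ` J"
      using off_nodes_shifted[of "- 1"] by auto
    have I: "T (\<lambda>r. r \<le> \<theta> k) = T (\<lambda>r. r \<le> s) + (\<Sum>i | i \<in> I \<and> - 1 / (t i - s) \<le> - 1 / (\<theta> k - s). u i)"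
      unfolding T_def
    proof (rule sum_Collect_split)
      show "t i \<le> \<theta> k \<longleftrightarrow> t i \<le> s \<or> - 1 / (t i - s) \<le> - 1 / (\<theta> k - s)"
        "\<not> (t i \<le> s \<and> - 1 / (t i - s) \<le> - 1 / (\<theta> k - s))" if "i \<in> I" for i
        using inverse_shift_order(4)[OF pole(1)[OF that] right] pole(1)[OF that] right by auto
    qed (rule finite)
    have J: "\<Theta> (\<lambda>r. r \<le> \<theta> k) = \<Theta> (\<lambda>r. r \<le> s) + (\<Sum>j | j \<in> J \<and> - 1 / (\<theta> j - s) \<le> - 1 / (\<theta> k - s). v j)"
      unfolding \<Theta>_def
    proof (rule sum_Collect_split)
      show "\<theta> j \<le> \<theta> k \<longleftrightarrow> \<theta> j \<le> s \<or> - 1 / (\<theta> j - s) \<le> - 1 / (\<theta> k - s)"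
        "\<not> (\<theta> j \<le> s \<and> - 1 / (\<theta> j - s) \<le> - 1 / (\<theta> k - s))" if "j \<in> J" for j
        using inverse_shift_order(4)[OF pole(2)[OF that] right] pole(2)[OF that] right by auto
    qed (rule finite)
    \<comment> \<open>Nodes beyond \<open>\<theta> k\<close> keep their order, and nodes left of
      \<open>s\<close> wrap around to positive values.\<close>
    have "- 1 / (\<theta> k - s) < - 1 / (\<theta> l - s)" if "l \<in> J" "\<theta> k < \<theta> l \<or> \<theta> l < s"
      using inverse_shift_order(4)[OF pole(2)[OF that(1)] right] that right by (simp only: not_le[symmetric]) auto
    then show ?thesis
      using Q.sum_le_node(1)[OF k] Q.sum_le_node(2)[OF k, of l i] i I J right by auto
  qed
  show "T (\<lambda>r. r \<le> \<theta> k) - \<Theta> (\<lambda>r. r \<le> \<theta> k) \<le> T (\<lambda>r. r \<le> s) - \<Theta> (\<lambda>r. r \<le> s)"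
    and "\<lbrakk>l \<in> J; \<theta> k < \<theta> l \<and> \<theta> l < s \<or> s < \<theta> k \<and> (\<theta> k < \<theta> l \<or> \<theta> l < s)\<rbrakk> \<Longrightarrow>
      T (\<lambda>r. r \<le> \<theta> k) - \<Theta> (\<lambda>r. r \<le> \<theta> k) < T (\<lambda>r. r \<le> s) - \<Theta> (\<lambda>r. r \<le> s)"
    using both by blast+
qed

text \<open>Mirror image of \<open>node_le\<close>: reflecting points, nodes and \<open>s\<close>
  gives a bound on masses at or right of \<open>\<theta> k\<close>, and the equality of the totals
  turns it into one on the complements.\<close>

lemma node_ge:
  assumes k: "k \<in> J"
  defines "T \<equiv> \<lambda>P. \<Sum>i | i \<in> I \<and> P (t i). u i" and "\<Theta> \<equiv> \<lambda>P. \<Sum>j | j \<in> J \<and> P (\<theta> j). v j"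
  shows "T (\<lambda>r. r \<le> s) - \<Theta> (\<lambda>r. r \<le> s) \<le> T (\<lambda>r. r < \<theta> k) - \<Theta> (\<lambda>r. r < \<theta> k)"
    and "\<lbrakk>l \<in> J; s < \<theta> l \<and> \<theta> l < \<theta> k \<or> \<theta> k < s \<and> (\<theta> l < \<theta> k \<or> s < \<theta> l)\<rbrakk> \<Longrightarrow>
      T (\<lambda>r. r \<le> s) - \<Theta> (\<lambda>r. r \<le> s) < T (\<lambda>r. r < \<theta> k) - \<Theta> (\<lambda>r. r < \<theta> k)"
proof -
  interpret refl: pole_quadrature I J "\<lambda>i. - t i" "\<lambda>j. - \<theta> j" u v "- s"
  proof (rule pole_quadrature.intro)
    \<comment> \<open>Since \<open>- t i - - s\<close> is \<open>- (t i - s)\<close>, the reflected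
      rule for \<open>\<kappa>\<close> is the original one for \<open>- \<kappa>\<close>.\<close>
    fix \<kappa> :: real assume "\<kappa> \<noteq> 0"
    then show "quadrature I J (\<lambda>i. \<kappa> / (- t i - - s)) (\<lambda>j. \<kappa> / (- \<theta> j - - s)) u v"
      using quadrature[of "- \<kappa>"] by (simp add: minus_divide_left[symmetric] minus_divide_right)
  qed (use pole off_nodes in auto)
  have total: "sum u I = sum v J"
    using quadrature.total_eq[OF quadrature[of 1]] by simp
  have I: "sum u I = T (\<lambda>r. r < r0) + (\<Sum>i | i \<in> I \<and> r0 \<le> t i. u i)" for r0
    unfolding T_def by (rule sum_split_at) (rule finite)
  have J: "sum v J = \<Theta> (\<lambda>r. r < r0) + (\<Sum>j | j \<in> J \<and> r0 \<le> \<theta> j. v j)" for r0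
    unfolding \<Theta>_def by (rule sum_split_at) (rule finite)
  \<comment> \<open>Taking complements trades \<open>\<le>\<close> for \<open><\<close>, which
    changes nothing at \<open>s\<close>, as it is neither a point nor a node.\<close>
  have s: "T (\<lambda>r. r \<le> s) = T (\<lambda>r. r < s)" "\<Theta> (\<lambda>r. r \<le> s) = \<Theta> (\<lambda>r. r < s)"
    using pole unfolding T_def \<Theta>_def by (auto intro!: sum.cong simp: order.order_iff_strict)
  show "T (\<lambda>r. r \<le> s) - \<Theta> (\<lambda>r. r \<le> s) \<le> T (\<lambda>r. r < \<theta> k) - \<Theta> (\<lambda>r. r < \<theta> k)"
    using refl.node_le(1)[OF k] I[of s] J[of s] I[of "\<theta> k"] J[of "\<theta> k"] total s by simp
  show "T (\<lambda>r. r \<le> s) - \<Theta> (\<lambda>r. r \<le> s) < T (\<lambda>r. r < \<theta> k) - \<Theta> (\<lambda>r. r < \<theta> k)"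
    if "l \<in> J" "s < \<theta> l \<and> \<theta> l < \<theta> k \<or> \<theta> k < s \<and> (\<theta> l < \<theta> k \<or> s < \<theta> l)"
    using refl.node_le(2)[OF k, of l] that I[of s] J[of s] I[of "\<theta> k"] J[of "\<theta> k"] total s by auto
qed

end

section \<open>The gap index and the final inequalities\<close>

text \<open>The gaps between increasing nodes are disjoint, so the description by \<open>THE\<close>
  is unique. The contrapositive serves the strict claims: for \<open>k\<close> other than the gap
  index, \<open>s\<close> is not between \<open>\<theta> k\<close> and
  \<open>\<theta> (k + 1)\<close>.\<close>

lemma gap_index_eqI:
  assumes "strict_mono_on {1..m} \<theta>" "k \<in> {1..<m}" "\<theta> k < s" "s < \<theta> (k + 1)"
  shows "gap_index m \<theta> s = k"
proof -
  have mono: "\<theta> i \<le> \<theta> j" if "i \<in> {1..m}" "j \<in> {1..m}" "i \<le> j" for i j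
    using that strict_mono_on_leD[OF assms(1)] by auto
  have "\<theta> 1 < s" "s < \<theta> m"
    using assms(2-4) mono[of 1 k] mono[of "k + 1" m] by auto
  moreover have "(THE k. k \<in> {1..<m} \<and> \<theta> k < s \<and> s < \<theta> (k + 1)) = k"
  proof (rule the_equality)
    fix k' assume k': "k' \<in> {1..<m} \<and> \<theta> k' < s \<and> s < \<theta> (k' + 1)"
    show "k' = k"
    proof (rule ccontr)
      assume "k' \<noteq> k"
      then consider "k' + 1 \<le> k" | "k + 1 \<le> k'" by linarith
      then show False
        using k' assms(2-4) mono[of "k' + 1" k] mono[of "k + 1" k'] by cases auto
    qed
  qed (use assms in auto)
  ultimately show ?thesis by (simp add: gap_index_def)
qed

theorem proposition4p13:
  fixes m n :: nat and a b :: ereal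
    and lam \<theta> :: "nat \<Rightarrow> real" and w c :: "nat \<Rightarrow> complex" and s \<gamma> :: real
  assumes "1 \<le> m" and "m < n"
    and "strict_mono_on {1..n} lam"
    and "\<And>j. j \<in> {1..n} \<Longrightarrow> a < ereal (lam j) \<and> ereal (lam j) < b"
    and "\<And>j. j \<in> {1..n} \<Longrightarrow> w j \<noteq> 0"
    and "\<And>j. j \<in> {1..n} \<Longrightarrow> s \<noteq> lam j"
    and "strict_mono_on {1..m} \<theta>"
    and "\<And>j. j \<in> {1..m} \<Longrightarrow> a < ereal (\<theta> j) \<and> ereal (\<theta> j) < b"
    and "\<And>j. j \<in> {1..m} \<Longrightarrow> \<theta> j \<noteq> s"
    and "\<And>(p :: complex poly) (r :: real \<Rightarrow> complex).
           degree p \<le> 2 * m - 2 \<Longrightarrow>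
           r = (\<lambda>x. poly p (of_real x) / (of_real x - of_real s) ^ (2 * m - 2)) \<Longrightarrow>
           (\<Sum>j = 1..n. of_real ((cmod (w j))\<^sup>2) * r (lam j)) =
           (\<Sum>j = 1..m. of_real ((cmod (c j))\<^sup>2) * r (\<theta> j))"
    and "\<gamma> = step_fun n lam w s - step_fun m \<theta> c s"
  shows "(\<forall>k \<in> {1..m - 1}.
            step_fun n lam w (\<theta> k) \<le> (\<Sum>j = 1..k. (cmod (c j))\<^sup>2) + \<gamma> \<and>
            (\<Sum>j = 1..k. (cmod (c j))\<^sup>2) + \<gamma> \<le> left_lim (step_fun n lam w) (\<theta> (k + 1)) \<and>
            (k \<noteq> gap_index m \<theta> s \<longrightarrow>
              step_fun n lam w (\<theta> k) < (\<Sum>j = 1..k. (cmod (c j))\<^sup>2) + \<gamma> \<and>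
              (\<Sum>j = 1..k. (cmod (c j))\<^sup>2) + \<gamma> < left_lim (step_fun n lam w) (\<theta> (k + 1)))) \<and>
         (gap_index m \<theta> s \<noteq> m \<longrightarrow>
            step_fun n lam w (\<theta> m) \<le> (\<Sum>j = 1..m. (cmod (c j))\<^sup>2) + \<gamma> \<and>
            \<gamma> \<le> left_lim (step_fun n lam w) (\<theta> 1))"
proof -
  define W where "W j = (cmod (w j))\<^sup>2" for j
  define C where "C j = (cmod (c j))\<^sup>2" for j
  note lam_mono = assms(3) and \<theta>_mono = assms(7)
  have \<theta>_less: "\<theta> i < \<theta> j \<longleftrightarrow> i < j" and \<theta>_le: "\<theta> i \<le> \<theta> j \<longleftrightarrow> i \<le> j"
    if "i \<in> {1..m}" "j \<in> {1..m}" for i j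
    using that strict_mono_on_less[OF \<theta>_mono] strict_mono_on_less_eq[OF \<theta>_mono] by auto
  have lam_s: "lam j \<noteq> s" if "j \<in> {1..n}" for j
    using assms(6)[OF that] by simp
  interpret pole_quadrature "{1..n}" "{1..m}" lam \<theta> W C s
  proof (rule pole_quadrature.intro)
    fix \<kappa> :: real assume "\<kappa> \<noteq> 0"
    show "quadrature {1..n} {1..m} (\<lambda>i. \<kappa> / (lam i - s)) (\<lambda>j. \<kappa> / (\<theta> j - s)) W C"
    proof
      show "inj_on (\<lambda>j. \<kappa> / (\<theta> j - s)) {1..m}"
      proof (rule inj_onI)
        fix i j assume ij: "i \<in> {1..m}" "j \<in> {1..m}" "\<kappa> / (\<theta> i - s) = \<kappa> / (\<theta> j - s)"
        then have "\<theta> i = \<theta> j"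
          using \<open>\<kappa> \<noteq> 0\<close> assms(9)[of i] assms(9)[of j] by (simp add: frac_eq_eq)
        then show "i = j"
          using ij strict_mono_on_imp_inj_on[OF \<theta>_mono] by (auto dest: inj_onD)
      qed
      fix q :: "real poly" assume "degree q \<le> 2 * card {1..m} - 2"
      then obtain p :: "complex poly" where deg: "degree p \<le> 2 * m - 2" and
        p: "\<And>t. t \<noteq> s \<Longrightarrow> poly p (of_real t) / (of_real t - of_real s) ^ (2 * m - 2)
              = of_real (poly q (\<kappa> / (t - s)))"
        using poly_inverse_shift[of q "2 * m - 2" s \<kappa>] by auto
      \<comment> \<open>The points and nodes avoid \<open>s\<close>, so both sides of the complex
        hypothesis are images of real sums.\<close>
      have "complex_of_real (\<Sum>j = 1..n. W j * poly q (\<kappa> / (lam j - s)))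
          = of_real (\<Sum>j = 1..m. C j * poly q (\<kappa> / (\<theta> j - s)))"
        using assms(10)[OF deg refl] lam_s assms(9) by (simp add: p W_def C_def)
      then show "(\<Sum>j = 1..n. W j * poly q (\<kappa> / (lam j - s)))
          = (\<Sum>j = 1..m. C j * poly q (\<kappa> / (\<theta> j - s)))"
        by (simp only: of_real_eq_iff)
    qed (auto simp: W_def)
  next
    \<comment> \<open>Fewer nodes than points: some point is off the nodes, which is the source of
      strictness.\<close>
    have "\<not> lam ` {1..n} \<subseteq> \<theta> ` {1..m}"
    proof
      assume "lam ` {1..n} \<subseteq> \<theta> ` {1..m}"
      then have "card (lam ` {1..n}) \<le> card (\<theta> ` {1..m})"
        by (intro card_mono) auto
      also have "\<dots> \<le> m" using card_image_le[of "{1..m}" \<theta>] by simp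
      finally show False
        using card_image[OF strict_mono_on_imp_inj_on[OF lam_mono]] \<open>m < n\<close> by simp
    qed
    then show "\<exists>i\<in>{1..n}. 0 < W i \<and> lam i \<notin> \<theta> ` {1..m}"
      using assms(5) by (force simp: W_def)
  qed (rule lam_s assms(9); assumption)+
  have \<gamma>: "\<gamma> = (\<Sum>i | i \<in> {1..n} \<and> lam i \<le> s. W i) - (\<Sum>j | j \<in> {1..m} \<and> \<theta> j \<le> s. C j)"
    using assms(11) by (simp add: step_fun_def W_def C_def)
  have upto: "(\<Sum>j | j \<in> {1..m} \<and> \<theta> j \<le> \<theta> k. C j) = (\<Sum>j = 1..k. C j)" if "k \<in> {1..m}" for k
    using that by (intro sum.cong) (auto simp: \<theta>_le)
  have below: "(\<Sum>j | j \<in> {1..m} \<and> \<theta> j < \<theta> (k + 1). C j) = (\<Sum>j = 1..k. C j)"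
    if "k + 1 \<in> {1..m}" for k
    using that by (intro sum.cong) (auto simp: \<theta>_less)
  have lower: "step_fun n lam w (\<theta> k) \<le> (\<Sum>j = 1..k. C j) + \<gamma>" if "k \<in> {1..m}" for k
    using node_le(1)[OF that] upto[OF that] \<gamma> by (simp add: step_fun_def W_def)
  have upper: "(\<Sum>j = 1..k. C j) + \<gamma> \<le> left_lim (step_fun n lam w) (\<theta> (k + 1))"
    if "k + 1 \<in> {1..m}" for k
    using node_ge(1)[OF that] below[OF that] \<gamma> by (simp add: left_lim_step_fun W_def)
  have strict: "step_fun n lam w (\<theta> k) < (\<Sum>j = 1..k. C j) + \<gamma>"
    "(\<Sum>j = 1..k. C j) + \<gamma> < left_lim (step_fun n lam w) (\<theta> (k + 1))"
    if k: "k \<in> {1..m - 1}" and "k \<noteq> gap_index m \<theta> s" for k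
  proof -
    have k': "k \<in> {1..m}" "k + 1 \<in> {1..m}" using k by auto
    have less: "\<theta> k < \<theta> (k + 1)" using \<theta>_less[OF k'] by simp
    have "\<not> (\<theta> k < s \<and> s < \<theta> (k + 1))"
      using gap_index_eqI[OF \<theta>_mono, of k s] that(2) k' by auto
    then have s: "\<theta> (k + 1) < s \<or> s < \<theta> k"
      using assms(9)[OF k'(1)] assms(9)[OF k'(2)] by linarith
    \<comment> \<open>The neighbour \<open>\<theta> (k + 1)\<close> is the extra node for the bound
      at \<open>\<theta> k\<close>; below, the two exchange roles.\<close>
    have "\<theta> k < \<theta> (k + 1) \<and> \<theta> (k + 1) < s \<or> s < \<theta> k \<and> (\<theta> k < \<theta> (k + 1) \<or> \<theta> (k + 1) < s)"
      using s less by auto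
    from node_le(2)[OF k' this] upto[OF k'(1)] \<gamma>
    show "step_fun n lam w (\<theta> k) < (\<Sum>j = 1..k. C j) + \<gamma>"
      by (simp add: step_fun_def W_def)
    have "s < \<theta> k \<and> \<theta> k < \<theta> (k + 1) \<or> \<theta> (k + 1) < s \<and> (\<theta> k < \<theta> (k + 1) \<or> s < \<theta> k)"
      using s less by auto
    from node_ge(2)[OF k'(2,1) this] below[OF k'(2)] \<gamma>
    show "(\<Sum>j = 1..k. C j) + \<gamma> < left_lim (step_fun n lam w) (\<theta> (k + 1))"
      by (simp add: left_lim_step_fun W_def)
  qed
  \<comment> \<open>The two end inequalities are boundary cases: \<open>lower\<close> at
    \<open>k = m\<close>, and \<open>upper\<close> at \<open>k = 0\<close> with an empty
    sum.\<close>
  show ?thesis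
    using lower upper[of 0] upper strict \<open>1 \<le> m\<close> unfolding C_def by auto
qed

end
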